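(* Let $X$ be a separable normed linear space over $\mathbb K$ ($\mathbb K=\mathbb R$ or $\mathbb C$), regarded as the topological measure space $(X,\|\cdot\|,\mathscr A,\mu)$. Then a linear functional $f:X\to\mathbb K$ is absolutely continuous if and only if $f$ is bounded.
   Context: The structure on $X$: $X$ carries its norm topology and norm metric. Define $\nu:2^X\to[0,\infty]$ by $\nu(A):=\inf\{\sum_{n\in\mathbb N}\operatorname{diam}(B_n): A\subseteq\bigcup_{n\in\mathbb N}B_n,\ B_n\text{ open for all }n\}$. A set $A\subseteq X$ is $\nu$-measurable if $\nu(D)=\nu(D\cap A)+\nu(D\smallsetminus A)$ for all $D\subseteq X$; $\mathscr A$ is the $\sigma$-algebra of $\nu$-measurable sets and $\mu:=\nu|_{\mathscr A}$. Given a topological space $(X,\tau)$ and a measure space $(X,\mathscr M,m)$, $(X,\tau,\mathscr M,m)$ is called a topological measure space (tms) if: (i) $\mathscr M$ contains all open sets; (ii) for every $x\in X$ and $\varepsilon>0$ there is an open connected neighbourhood $U$ of $x$ with $m(U)<\varepsilon$; (iii) for every open $G$ and $x\in G$ there is $\varepsilon>0$ such that every open connected neighbourhood $U$ of $x$ with $m(U)<\varepsilon$ satisfies $U\subseteq G$. In the paper $(X,\|\cdot\|,\mathscr A,\mu)$ is regarded as a tms for every separable normed linear space $X$. For $\delta>0$, $\mathcal P_\delta$ denotes the collection of all countable (finite or infinite) families $\{E_i\}_i$ of pairwise disjoint open connected subsets of $X$ with $\sum_i \mu(E_i)<\delta$. A function $f:X\to\mathbb K$ is absolutely continuous if for every $\varepsilon>0$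 there exists $\delta>0$ such that for every $\{D_i\}_i\in\mathcal P_\delta$ one has $\sum_i\omega(f,D_i)<\varepsilon$, where $\omega(f,D):=\sup\{|f(x)-f(y)|:x,y\in D\}$.
   Formalization: Sizes of the open connected sets E_i are measured by the outer measure ν instead of μ, because open sets need not be ν-measurable (e.g. an open half-plane in the plane), so μ(E_i) may be undefined; the two agree whenever E_i is measurable. *)

theory Defs
  imports "HOL-Analysis.Analysis"
begin

text \<open>
  The diameter as an extended real: it is \<open>\<infinity>\<close> on unbounded sets, where the library's
  \<^const>\<open>diameter\<close> is \<open>0\<close>.
\<close>

definition ediam :: "'a::metric_space set \<Rightarrow> ennreal" where
  "ediam A = (SUP x\<in>A. SUP y\<in>A. ennreal (dist x y))"

definition nu :: "'a::metric_space set \<Rightarrow> ennreal" where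
  "nu A = (INF B \<in> {B :: nat \<Rightarrow> 'a set. (\<forall>n. open (B n)) \<and> A \<subseteq> (\<Union>n. B n)}. \<Sum>n. ediam (B n))"

definition nu_measurable :: "'a::metric_space set \<Rightarrow> bool" where
  "nu_measurable A \<longleftrightarrow> (\<forall>D. nu D = nu (D \<inter> A) + nu (D - A))"

definition mu :: "'a::metric_space measure" where
  "mu = measure_of UNIV {A. nu_measurable A} nu"

lemma nu_le:
  assumes "\<And>n. open (B n)" "A \<subseteq> (\<Union>n. B n)"
  shows "nu A \<le> (\<Sum>n. ediam (B n))"
  unfolding nu_def using assms by (intro INF_lower) auto

lemma nu_empty: "nu {} = 0"
  using nu_le[of "\<lambda>_. {}" "{}"] by (simp add: ediam_def bot_ennreal)

lemma nu_mono: "A \<subseteq> B \<Longrightarrow> nu A \<le> nu B"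
  unfolding nu_def by (intro INF_superset_mono) auto

lemma nu_countably_subadditive:
  fixes A :: "nat \<Rightarrow> 'a::metric_space set"
  shows "nu (\<Union>i. A i) \<le> (\<Sum>i. nu (A i))"
proof (rule ennreal_le_epsilon)
  fix e :: real
  assume fin: "(\<Sum>i. nu (A i)) < top" and e: "0 < e"
  have "\<exists>B. (\<forall>n. open (B n)) \<and> A i \<subseteq> (\<Union>n. B n) \<and>
          (\<Sum>n. ediam (B n)) \<le> nu (A i) + ennreal (e * (1/2)^Suc i)" for i
  proof -
    have "nu (A i) < nu (A i) + e * (1/2)^Suc i"
      using fin e by (auto simp add: less_top dest!: ennreal_suminf_lessD)
    then show ?thesis
      unfolding nu_def[of "A i"] INF_less_iff by (blast intro: less_imp_le)
  qed
  then obtain B where B: "\<And>i n. open (B i n)" "\<And>i. A i \<subseteq> (\<Union>n. B i n)"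
    "\<And>i. (\<Sum>n. ediam (B i n)) \<le> nu (A i) + ennreal (e * (1/2)^Suc i)"
    by metis
  define C where "C = case_prod B \<circ> prod_decode"
  have C: "(\<Union>i. A i) \<subseteq> (\<Union>n. C n)"
  proof
    fix x assume "x \<in> (\<Union>i. A i)"
    then obtain i n where "x \<in> B i n" using B(2) by blast
    then have "x \<in> C (prod_encode (i, n))" by (simp add: C_def)
    then show "x \<in> (\<Union>n. C n)" by blast
  qed
  have "nu (\<Union>i. A i) \<le> (\<Sum>n. ediam (C n))"
    by (rule nu_le[OF _ C]) (simp add: C_def B(1) case_prod_unfold)
  also have "\<dots> = (\<Sum>i. \<Sum>n. ediam (B i n))"
    unfolding C_def comp_def by (intro suminf_ennreal_2dimen) auto
  also have "\<dots> \<le> (\<Sum>i. nu (A i) + ennreal (e * (1/2)^Suc i))"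
    by (intro suminf_le B(3)) auto
  also have "\<dots> = (\<Sum>i. nu (A i)) + (\<Sum>n. ennreal e * ennreal ((1/2) ^ Suc n))"
    using \<open>0 < e\<close> by (subst suminf_add[symmetric])
      (auto simp del: ennreal_suminf_cmult simp add: ennreal_mult[symmetric])
  also have "\<dots> = (\<Sum>i. nu (A i)) + ennreal e"
    unfolding ennreal_suminf_cmult
    by (subst suminf_ennreal_eq[OF zero_le_power power_half_series]) auto
  finally show "nu (\<Union>i. A i) \<le> (\<Sum>i. nu (A i)) + ennreal e" .
qed

lemma measure_space_nu: "measure_space UNIV {A :: 'a::metric_space set. nu_measurable A} nu"
proof -
  interpret sigma_algebra UNIV "UNIV :: 'a set set"
    using sigma_algebra_Pow[of "UNIV :: 'a set"] by simp
  have "outer_measure_space (UNIV :: 'a set set) nu"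
    by (auto simp: outer_measure_space_def positive_def increasing_def countably_subadditive_def
        nu_empty nu_mono nu_countably_subadditive)
  then have "measure_space UNIV (lambda_system UNIV (UNIV :: 'a set set) nu) nu"
    by (rule caratheodory_lemma)
  moreover have "lambda_system UNIV UNIV nu = {A :: 'a set. nu_measurable A}"
    unfolding lambda_system_eq nu_measurable_def by (simp add: eq_commute[of "_ + _"])
  ultimately show ?thesis
    by (simp only:)
qed

lemma sets_mu: "sets mu = {A :: 'a::metric_space set. nu_measurable A}"
proof -
  have "sigma_algebra UNIV {A :: 'a set. nu_measurable A}"
    using measure_space_nu by (auto simp: measure_space_def)
  then show ?thesis
    unfolding mu_def by (rule sigma_algebra.sets_measure_of_eq)
qed

lemma emeasure_mu:
  fixes A :: "'a::metric_space set"
  assumes "nu_measurable A"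
  shows "emeasure mu A = nu A"
proof (rule emeasure_measure_of[OF mu_def])
  show "positive (sets (mu :: 'a measure)) nu" "countably_additive (sets (mu :: 'a measure)) nu"
    using measure_space_nu[where 'a='a] unfolding sets_mu measure_space_def by blast+
next
  show "A \<in> sets mu"
    using assms by (simp only: sets_mu mem_Collect_eq)
qed simp

definition oscillation :: "('a \<Rightarrow> 'k::real_normed_field) \<Rightarrow> 'a set \<Rightarrow> ennreal" where
  "oscillation f D = (SUP x\<in>D. SUP y\<in>D. ennreal (norm (f x - f y)))"

text \<open>
  A countable family is indexed by a set \<open>I\<close> of natural numbers, so that finite and infinite
  families are both covered.

  The size of the members of a family is measured by \<^const>\<open>nu\<close> and not by
  \<^term>\<open>emeasure mu\<close>. The two agree on every measurable set (\<open>emeasure_mu\<close>), but open connected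
  sets need not be measurable: \<open>nu\<close> of an open connected set is its diameter, so in the
  Euclidean plane the open unit disc and its two open halves (cut along a diameter) all have
  \<open>nu\<close> equal to 2, and an open half-plane is not measurable. On nonmeasurable
  sets \<^const>\<open>emeasure\<close> is \<open>0\<close> by convention, which would be meaningless here.
\<close>

definition admissible_family ::
    "real \<Rightarrow> nat set \<Rightarrow> (nat \<Rightarrow> 'a::metric_space set) \<Rightarrow> bool" where
  "admissible_family \<delta> I E \<longleftrightarrow>
     disjoint_family_on E I \<and> (\<forall>i\<in>I. open (E i) \<and> connected (E i)) \<and>
     (\<Sum>\<^sub>\<infinity>i\<in>I. nu (E i)) < ennreal \<delta>"

definition abs_continuous :: "('a::metric_space \<Rightarrow> 'k::real_normed_field) \<Rightarrow> bool" where
  "abs_continuous f \<longleftrightarrow>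
     (\<forall>\<epsilon>>0. \<exists>\<delta>>0. \<forall>I D. admissible_family \<delta> I D \<longrightarrow>
        (\<Sum>\<^sub>\<infinity>i\<in>I. oscillation f (D i)) < ennreal \<epsilon>)"

definition bounded_functional :: "('a::real_normed_vector \<Rightarrow> 'k::real_normed_field) \<Rightarrow> bool" where
  "bounded_functional f \<longleftrightarrow> (\<exists>C. \<forall>x. norm (f x) \<le> C * norm x)"

text \<open>
  A complex normed space, presented as a real normed space together with a compatible complex
  scalar multiplication.
\<close>

locale complex_normed_space = vector_space scaleC
  for scaleC :: "complex \<Rightarrow> 'a::real_normed_vector \<Rightarrow> 'a" +
  assumes scaleC_of_real: "scaleC (complex_of_real r) x = r *\<^sub>R x"
    and norm_scaleC: "norm (scaleC c x) = cmod c * norm x"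

end

theory Submission
  imports Defs
begin

text \<open>
  Everything rests on one geometric fact: for a connected set the outer measure \<open>nu\<close> is at least
  the diameter (\<open>ediam_le_nu\<close>), because chaining sets of small diameter across a
  connected set costs at least the distance covered. The function \<open>dist x\<close> turns this into a
  statement about the real line: it does not increase diameters, and it maps a connected set
  containing \<open>x\<close> and \<open>y\<close> onto a set containing the interval from \<open>0\<close> to
  \<open>dist x y\<close>, where countable subadditivity of Lebesgue measure applies.

  A bounded linear functional \<open>f\<close> with constant \<open>K\<close> satisfies
  \<open>oscillation f D \<le> K * ediam D\<close>, so the oscillations of an admissible family add up to at most
  \<open>K\<close> times the total of its \<open>nu\<close>-values. Conversely, a one-member family consisting of a small
  ball about the origin is admissible, so absolute continuity bounds \<open>f\<close> on that ball, and
  homogeneity spreads the bound to the whole space. A complex-linear functional is in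
  particular real-linear, so both scalar fields are instances of one statement about real-linear
  maps into a real normed field.
\<close>

lemma ediam_le_iff: "ediam A \<le> c \<longleftrightarrow> (\<forall>x\<in>A. \<forall>y\<in>A. ennreal (dist x y) \<le> c)"
  by (simp add: ediam_def SUP_le_iff)

lemma dist_le_ediam: "x \<in> A \<Longrightarrow> y \<in> A \<Longrightarrow> ennreal (dist x y) \<le> ediam A"
  using ediam_le_iff[of A "ediam A"] by simp

lemma oscillation_le_iff:
  "oscillation f D \<le> c \<longleftrightarrow> (\<forall>x\<in>D. \<forall>y\<in>D. ennreal (norm (f x - f y)) \<le> c)"
  by (simp add: oscillation_def SUP_le_iff)

lemma norm_diff_le_oscillation:
  "x \<in> D \<Longrightarrow> y \<in> D \<Longrightarrow> ennreal (norm (f x - f y)) \<le> oscillation f D"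
  using oscillation_le_iff[of f D "oscillation f D"] by simp

lemma ediam_dist_image_le: "ediam (dist x ` B) \<le> ediam B"
  unfolding ediam_le_iff
proof safe
  fix y z assume "y \<in> B" "z \<in> B"
  have "dist (dist x y) (dist x z) \<le> dist y z"
    using abs_dist_diff_le[of y x z] by (simp add: dist_real_def dist_commute)
  then show "ennreal (dist (dist x y) (dist x z)) \<le> ediam B"
    using dist_le_ediam[OF \<open>y \<in> B\<close> \<open>z \<in> B\<close>] by (meson ennreal_leI order_trans)
qed

text \<open>
  The bridge from diameters to Lebesgue measure: a set of reals lies in its closed convex hull,
  whose length is the diameter of the set.
\<close>

lemma real_set_cover_by_ediam:
  fixes S :: "real set"
  obtains J where "J \<in> sets lborel" "S \<subseteq> J" "emeasure lborel J \<le> ediam S"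
proof (cases "S = {} \<or> ediam S = top")
  case True
  then show thesis
  proof
    assume "S = {}" then show thesis by (intro that[of "{}"]) auto
  next
    assume "ediam S = top" then show thesis by (intro that[of UNIV]) auto
  qed
next
  case False
  then obtain r where r: "r \<ge> 0" "ediam S = ennreal r"
    by (cases "ediam S") auto
  have close: "x - r \<le> y" if "x \<in> S" "y \<in> S" for x y
    using dist_le_ediam[OF that] r by (simp add: dist_real_def)
  obtain p where p: "p \<in> S" using False by blast
  have bdd: "bdd_below S" "bdd_above S"
    using close[OF p] close[OF _ p]
    by (auto simp: algebra_simps intro!: bdd_belowI[of _ "p - r"] bdd_aboveI[of _ "p + r"])
  have "x - r \<le> Inf S" if "x \<in> S" for x
    using p close[OF that] by (intro cInf_greatest) auto
  then have "Sup S \<le> Inf S + r"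
    using p by (intro cSup_least) (auto simp: algebra_simps)
  moreover have "Inf S \<le> Sup S"
    using cInf_lower[OF p bdd(1)] cSup_upper[OF p bdd(2)] by linarith
  ultimately have "emeasure lborel {Inf S..Sup S} \<le> ediam S"
    using r by (simp add: ennreal_leI)
  moreover have "S \<subseteq> {Inf S..Sup S}"
    using bdd by (auto intro: cInf_lower cSup_upper)
  ultimately show thesis by (intro that[of "{Inf S..Sup S}"]) auto
qed

lemma dist_le_suminf_ediam_cover:
  fixes A :: "'a::metric_space set"
  assumes "connected A" "x \<in> A" "y \<in> A" and cover: "A \<subseteq> (\<Union>n. B n)"
  shows "ennreal (dist x y) \<le> (\<Sum>n::nat. ediam (B n))"
proof -
  have "\<exists>J. J \<in> sets lborel \<and> dist x ` B n \<subseteq> J \<and> emeasure lborel J \<le> ediam (dist x ` B n)" for n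
    by (rule real_set_cover_by_ediam[of "dist x ` B n"]) blast
  then obtain J where J: "\<And>n. J n \<in> sets lborel" "\<And>n. dist x ` B n \<subseteq> J n"
    "\<And>n. emeasure lborel (J n) \<le> ediam (dist x ` B n)"
    by metis
  have "connected (dist x ` A)"
    using assms(1) by (intro connected_continuous_image continuous_intros)
  moreover have "0 \<in> dist x ` A" using \<open>x \<in> A\<close> by (metis dist_self image_eqI)
  moreover have "dist x y \<in> dist x ` A" using \<open>y \<in> A\<close> by blast
  ultimately have "{0..dist x y} \<subseteq> dist x ` A"
    by (rule connected_contains_Icc)
  also have "\<dots> \<subseteq> (\<Union>n. J n)" using cover J(2) by blast
  finally have "{0..dist x y} \<subseteq> (\<Union>n. J n)" .
  then have "emeasure lborel {0..dist x y} \<le> emeasure lborel (\<Union>n. J n)"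
    using J(1) by (intro emeasure_mono) auto
  also have "\<dots> \<le> (\<Sum>n. emeasure lborel (J n))"
    using J(1) by (intro emeasure_subadditive_countably) auto
  also have "\<dots> \<le> (\<Sum>n. ediam (B n))"
    using J(3) ediam_dist_image_le by (intro suminf_le) (auto intro: order_trans)
  finally show ?thesis by simp
qed

lemma ediam_le_nu: "connected A \<Longrightarrow> ediam A \<le> nu A"
  unfolding nu_def ediam_le_iff
  by (auto intro!: INF_greatest dist_le_suminf_ediam_cover[of A])

lemma nu_le_ediam:
  assumes "open A"
  shows "nu A \<le> ediam A"
proof -
  have "nu A \<le> (\<Sum>n. ediam (if n = (0::nat) then A else {}))"
    using assms by (intro nu_le) auto
  also have "\<dots> = (\<Sum>n\<in>{0::nat}. ediam (if n = 0 then A else {}))"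
    by (intro suminf_finite) (auto simp: ediam_def bot_ennreal)
  finally show ?thesis by simp
qed

lemma infsum_le_mult_ennreal:
  fixes f g :: "'i \<Rightarrow> ennreal"
  assumes "\<And>i. i \<in> I \<Longrightarrow> f i \<le> c * g i"
  shows "(\<Sum>\<^sub>\<infinity>i\<in>I. f i) \<le> c * (\<Sum>\<^sub>\<infinity>i\<in>I. g i)"
  unfolding nonneg_infsum_complete[of I f, OF zero_le]
proof (rule SUP_least, clarify)
  fix F assume F: "finite F" "F \<subseteq> I"
  have "sum f F \<le> c * sum g F"
    unfolding sum_distrib_left using F assms by (intro sum_mono) auto
  also have "\<dots> \<le> c * (\<Sum>\<^sub>\<infinity>i\<in>I. g i)"
    unfolding nonneg_infsum_complete[of I g, OF zero_le]
    using F by (intro mult_left_mono SUP_upper) auto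
  finally show "sum f F \<le> c * (\<Sum>\<^sub>\<infinity>i\<in>I. g i)" .
qed

lemma bounded_imp_abs_continuous:
  fixes f :: "'a::real_normed_vector \<Rightarrow> 'k::real_normed_field"
  assumes "linear f" "bounded_functional f"
  shows "abs_continuous f"
  unfolding abs_continuous_def
proof (intro allI impI)
  fix \<epsilon> :: real assume "\<epsilon> > 0"
  obtain C where C: "\<And>x. norm (f x) \<le> C * norm x"
    using assms(2) unfolding bounded_functional_def by blast
  \<comment> \<open>The constant is made positive so that it can be divided by.\<close>
  define K where "K = max C 1"
  have K: "K > 0" by (simp add: K_def)
  have lip: "norm (f x - f y) \<le> K * dist x y" for x y
  proof -
    have "norm (f x - f y) \<le> C * norm (x - y)"
      using C[of "x - y"] by (simp add: linear_diff[OF assms(1)])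
    also have "\<dots> \<le> K * norm (x - y)" by (intro mult_right_mono) (auto simp: K_def)
    finally show ?thesis by (simp add: dist_norm)
  qed
  have osc: "oscillation f D \<le> ennreal K * ediam D" for D
    unfolding oscillation_le_iff
  proof (intro ballI)
    fix x y assume "x \<in> D" "y \<in> D"
    have "ennreal (norm (f x - f y)) \<le> ennreal K * ennreal (dist x y)"
      using lip K by (simp add: ennreal_mult[symmetric] ennreal_leI)
    also have "\<dots> \<le> ennreal K * ediam D"
      using \<open>x \<in> D\<close> \<open>y \<in> D\<close> by (intro mult_left_mono dist_le_ediam) auto
    finally show "ennreal (norm (f x - f y)) \<le> ennreal K * ediam D" .
  qed
  show "\<exists>\<delta>>0. \<forall>I D. admissible_family \<delta> I D \<longrightarrow>
          (\<Sum>\<^sub>\<infinity>i\<in>I. oscillation f (D i)) < ennreal \<epsilon>"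
  proof (intro exI[of _ "\<epsilon> / K"] conjI allI impI)
    show "\<epsilon> / K > 0" using K \<open>\<epsilon> > 0\<close> by simp
  next
    fix I :: "nat set" and D :: "nat \<Rightarrow> 'a set"
    assume D: "admissible_family (\<epsilon> / K) I D"
    have "oscillation f (D i) \<le> ennreal K * nu (D i)" if "i \<in> I" for i
    proof -
      have "oscillation f (D i) \<le> ennreal K * ediam (D i)" by (rule osc)
      also have "\<dots> \<le> ennreal K * nu (D i)"
        using D that by (intro mult_left_mono ediam_le_nu) (auto simp: admissible_family_def)
      finally show ?thesis .
    qed
    then have "(\<Sum>\<^sub>\<infinity>i\<in>I. oscillation f (D i)) \<le> ennreal K * (\<Sum>\<^sub>\<infinity>i\<in>I. nu (D i))"
      by (rule infsum_le_mult_ennreal)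
    also have "\<dots> < ennreal K * ennreal (\<epsilon> / K)"
      using D K by (intro ennreal_mult_strict_left_mono) (auto simp: admissible_family_def)
    also have "\<dots> = ennreal \<epsilon>"
      using K \<open>\<epsilon> > 0\<close> by (simp add: ennreal_mult[symmetric])
    finally show "(\<Sum>\<^sub>\<infinity>i\<in>I. oscillation f (D i)) < ennreal \<epsilon>" .
  qed
qed

lemma abs_continuous_imp_bounded:
  fixes f :: "'a::real_normed_vector \<Rightarrow> 'k::real_normed_field"
  assumes "linear f" "abs_continuous f"
  shows "bounded_functional f"
proof -
  obtain \<delta> where \<delta>: "\<delta> > 0"
    "\<And>I D. admissible_family \<delta> I D \<Longrightarrow> (\<Sum>\<^sub>\<infinity>i\<in>I. oscillation f (D i)) < ennreal 1"
    using assms(2) unfolding abs_continuous_def by (meson zero_less_one)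
  \<comment> \<open>The diameter of the ball is at most \<open>2 * r\<close>, which must stay strictly below \<open>\<delta>\<close>.\<close>
  define r where "r = \<delta> / 3"
  have r: "r > 0" "2 * r < \<delta>" using \<delta>(1) by (auto simp: r_def)
  let ?U = "ball (0::'a) r"
  have "ediam ?U \<le> ennreal (2 * r)"
    unfolding ediam_le_iff
  proof (intro ballI ennreal_leI)
    fix x y assume "x \<in> ?U" "y \<in> ?U"
    then show "dist x y \<le> 2 * r" using dist_triangle[of x y 0] by (simp add: dist_commute)
  qed
  then have "nu ?U \<le> ennreal (2 * r)"
    using nu_le_ediam[of ?U] by (auto intro: order_trans)
  also have "\<dots> < ennreal \<delta>" using r by (intro ennreal_lessI) auto
  finally have "admissible_family \<delta> {0} (\<lambda>_. ?U)"
    by (auto simp: admissible_family_def disjoint_family_on_def)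
  from \<delta>(2)[OF this] have osc: "oscillation f ?U < 1" by simp
  have small: "norm (f x) \<le> 1" if "norm x < r" for x
  proof -
    have "ennreal (norm (f x - f 0)) \<le> oscillation f ?U"
      using that r by (intro norm_diff_le_oscillation) auto
    also have "\<dots> \<le> 1" using osc by (rule less_imp_le)
    finally show ?thesis by (simp add: linear_0[OF assms(1)])
  qed
  have "norm (f x) \<le> (2 / r) * norm x" for x
  proof (cases "x = 0")
    case True then show ?thesis by (simp add: linear_0[OF assms(1)])
  next
    case False
    \<comment> \<open>Rescale \<open>x\<close> to norm \<open>r / 2\<close>, inside the open ball.\<close>
    define t where "t = r / (2 * norm x)"
    have t: "t > 0" using r False by (simp add: t_def)
    have "norm (t *\<^sub>R x) < r" using r False by (simp add: t_def)
    then have "norm (f (t *\<^sub>R x)) \<le> 1" by (rule small)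
    then have "t * norm (f x) \<le> 1"
      using t by (simp add: linear_cmul[OF assms(1)])
    then show ?thesis using r False by (simp add: t_def field_simps)
  qed
  then show ?thesis unfolding bounded_functional_def by blast
qed

lemma abs_continuous_iff_bounded_functional:
  fixes f :: "'a::real_normed_vector \<Rightarrow> 'k::real_normed_field"
  assumes "linear f"
  shows "abs_continuous f \<longleftrightarrow> bounded_functional f"
  using assms bounded_imp_abs_continuous abs_continuous_imp_bounded by blast

lemma complex_linear_imp_linear:
  fixes f :: "'a::real_normed_vector \<Rightarrow> complex"
  assumes "complex_normed_space scaleC" "Vector_Spaces.linear scaleC (*) f"
  shows "linear f"
proof -
  interpret complex_normed_space scaleC by fact
  interpret f: Vector_Spaces.linear scaleC "(*)" f by fact
  show ?thesis
  proof (rule linearI)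
    show "f (x + y) = f x + f y" for x y by (rule f.add)
    show "f (c *\<^sub>R x) = c *\<^sub>R f x" for c x
      using f.scale[of "complex_of_real c" x] by (simp add: scaleC_of_real scaleR_conv_of_real)
  qed
qed

theorem corollary5p12:
  assumes "separable_space (euclidean :: 'a::real_normed_vector topology)"
  shows "(\<forall>f :: 'a \<Rightarrow> real. linear f \<longrightarrow> (abs_continuous f \<longleftrightarrow> bounded_functional f)) \<and>
    (\<forall>(scaleC :: complex \<Rightarrow> 'a \<Rightarrow> 'a) (f :: 'a \<Rightarrow> complex).
       complex_normed_space scaleC \<longrightarrow> Vector_Spaces.linear scaleC (*) f \<longrightarrow>
       (abs_continuous f \<longleftrightarrow> bounded_functional f))"
  by (intro conjI allI impI abs_continuous_iff_bounded_functional)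
    (auto intro: complex_linear_imp_linear)

end
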